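(* For all $\alpha>1$ and all $\boldsymbol{\lambda}\in\Lambda$, if $\alpha\boldsymbol{\lambda}\in\Lambda$, then $$\frac{c(\alpha\boldsymbol{\lambda})}{\|\alpha\boldsymbol{\lambda}\|}\le\frac{c(\boldsymbol{\lambda})}{\|\boldsymbol{\lambda}\|},$$ where $\|\cdot\|$ is the Euclidean norm.
   Context: Fix an integer $N\ge 1$ and write $[N]=\{1,\dots,N\}$. Costs $c_{(i)}>0$ and $c_{(i,j)}>0$ ($i,j\in[N]$) are given with $c_{(i)}=c_{(i,i)}\le c_{(i,j)}=c_{(j,i)}$ for all $i,j\in[N]$. The parameters $\theta_i\ge 0$ ($i\in[N]$) are given. The domain is the box $\Lambda=[\underline{\boldsymbol{\lambda}},\overline{\boldsymbol{\lambda}}]=\{\boldsymbol{\lambda}\in\mathbb{R}^N:\underline{\lambda}_i\le\lambda_i\le\overline{\lambda}_i\ \forall i\}$ with $\underline{\lambda}_i>0$ for all $i$. For $\boldsymbol{\lambda}\in\Lambda$, $c(\boldsymbol{\lambda})$ is the optimal value of the linear program in variables $\boldsymbol{x}=(x_{i,j})_{i,j\in[N]}$, $\boldsymbol{y}=(y_i)_{i\in[N]}$: minimize $\sum_{i,j\in[N]}c_{(i,j)}x_{i,j}+\sum_{i\in[N]}c_{(i)}y_i$ subject to $\sum_{j\in[N]}x_{j,i}+\sum_{j\in[N]}x_{i,j}+y_i=\lambda_i$ for all $i\in[N]$; $\theta_i x_{i,j}\le\lambda_j y_i$ for all $i,j\in[N]$; $x_{i,j}\ge 0$ for all $i,j\in[N]$;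 $y_i\ge 0$ for all $i\in[N]$. *)

theory Defs
  imports "HOL-Analysis.Analysis"
begin

text \<open>
  The index set \<open>[N]\<close> is a finite type \<open>'n\<close> (nonempty, so \<open>N = CARD('n) \<ge> 1\<close>).
  The variable \<open>x\<^sub>i\<^sub>,\<^sub>j\<close> is \<open>x $ i $ j\<close>.
\<close>

definition lp_feasible ::
  "('n::finite \<Rightarrow> real) \<Rightarrow> real ^ 'n \<Rightarrow> ((real ^ 'n ^ 'n) \<times> (real ^ 'n)) set" where
  "lp_feasible \<theta> lam = {(x, y).
     (\<forall>i. (\<Sum>j\<in>UNIV. x $ j $ i) + (\<Sum>j\<in>UNIV. x $ i $ j) + y $ i = lam $ i) \<and>
     (\<forall>i j. \<theta> i * x $ i $ j \<le> lam $ j * y $ i) \<and>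
     (\<forall>i j. 0 \<le> x $ i $ j) \<and>
     (\<forall>i. 0 \<le> y $ i)}"

definition lp_objective ::
  "('n::finite \<Rightarrow> real) \<Rightarrow> ('n \<Rightarrow> 'n \<Rightarrow> real) \<Rightarrow> real ^ 'n ^ 'n \<Rightarrow> real ^ 'n \<Rightarrow> real" where
  "lp_objective c1 c2 x y =
     (\<Sum>i\<in>UNIV. \<Sum>j\<in>UNIV. c2 i j * x $ i $ j) + (\<Sum>i\<in>UNIV. c1 i * y $ i)"

text \<open>
  The real infimum is the true optimal value only when the feasible set is nonempty and the
  objective is bounded below on it; the two lemmas that follow give this for nonnegative
  \<open>lam\<close> and nonnegative costs.
\<close>

definition opt_cost ::
  "('n::finite \<Rightarrow> real) \<Rightarrow> ('n \<Rightarrow> 'n \<Rightarrow> real) \<Rightarrow> ('n \<Rightarrow> real) \<Rightarrow> real ^ 'n \<Rightarrow> real" where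
  "opt_cost c1 c2 \<theta> lam = (INF (x, y) \<in> lp_feasible \<theta> lam. lp_objective c1 c2 x y)"

lemma lp_feasible_nonempty:
  fixes lam :: "real ^ 'n::finite"
  assumes "\<And>i. 0 \<le> lam $ i"
  shows "lp_feasible \<theta> lam \<noteq> {}"
proof -
  have "(0, lam) \<in> lp_feasible \<theta> lam"
    using assms by (simp add: lp_feasible_def)
  then show ?thesis by blast
qed

lemma lp_objective_bdd_below:
  fixes lam :: "real ^ 'n::finite"
  assumes "\<And>i. 0 \<le> c1 i" "\<And>i j. 0 \<le> c2 i j"
  shows "bdd_below ((\<lambda>(x, y). lp_objective c1 c2 x y) ` lp_feasible \<theta> lam)"
  by (rule bdd_belowI[where m = 0])
    (auto simp: lp_feasible_def lp_objective_def intro!: add_nonneg_nonneg sum_nonneg mult_nonneg_nonneg assms)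

end

theory Submission
  imports Defs
begin

text \<open>Compare the programs at \<open>lam\<close> and \<open>\<alpha> *\<^sub>R lam\<close> by
  scaling the variables with the same factor. The balance equations and the sign constraints are
  homogeneous of degree one, so they survive. In the coupling constraint the left side is linear in
  \<open>x\<close>, while the right side \<open>lam $ j * y $ i\<close> is a product of two scaled
  quantities and grows like the square of \<alpha>; being nonnegative, it only gains slack when
  \<alpha> is at least 1. Hence a feasible point stays feasible (\<open>lp_feasible_scaleR\<close>),
  its cost is multiplied by \<alpha> (\<open>lp_objective_scaleR\<close>), and the optimal value
  grows at most linearly along rays (\<open>opt_cost_scaleR_le\<close>). The norm grows exactly
  linearly, so the ratio cannot increase.\<close>

lemma lp_feasible_scaleR:
  fixes lam :: "real ^ 'n::finite"
  assumes "1 \<le> \<alpha>" and "\<And>i. 0 \<le> lam $ i" and xy: "(x, y) \<in> lp_feasible \<theta> lam"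
  shows "(\<alpha> *\<^sub>R x, \<alpha> *\<^sub>R y) \<in> lp_feasible \<theta> (\<alpha> *\<^sub>R lam)"
proof -
  have "\<theta> i * (\<alpha> * x $ i $ j) \<le> \<alpha> * lam $ j * (\<alpha> * y $ i)" for i j
  proof -
    have nonneg: "0 \<le> lam $ j * y $ i"
      using assms by (simp add: lp_feasible_def)
    have "\<theta> i * x $ i $ j \<le> lam $ j * y $ i"
      using xy by (simp add: lp_feasible_def)
    \<comment> \<open>The extra factor \<alpha> on the right is the surplus of degree two over
      degree one; this is where \<alpha> being at least 1 matters.\<close>
    also have "\<dots> \<le> \<alpha> * (lam $ j * y $ i)"
      using mult_right_mono[OF assms(1) nonneg] by simp
    finally have "\<alpha> * (\<theta> i * x $ i $ j) \<le> \<alpha> * (\<alpha> * (lam $ j * y $ i))"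
      using assms(1) by (intro mult_left_mono) auto
    then show ?thesis
      by (simp add: algebra_simps)
  qed
  moreover have "(\<Sum>j\<in>UNIV. \<alpha> * x $ j $ i) + (\<Sum>j\<in>UNIV. \<alpha> * x $ i $ j) + \<alpha> * y $ i = \<alpha> * lam $ i" for i
    using xy by (simp add: lp_feasible_def sum_distrib_left[symmetric] distrib_left[symmetric])
  ultimately show ?thesis
    using assms by (simp add: lp_feasible_def)
qed

lemma lp_objective_scaleR:
  "lp_objective c1 c2 (\<alpha> *\<^sub>R x) (\<alpha> *\<^sub>R y) = \<alpha> * lp_objective c1 c2 x y"
  by (simp add: lp_objective_def sum_distrib_left distrib_left mult.left_commute)

lemma opt_cost_scaleR_le:
  fixes lam :: "real ^ 'n::finite"
  assumes "1 \<le> \<alpha>" and lam: "\<And>i. 0 \<le> lam $ i"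
    and "\<And>i. 0 \<le> c1 i" and "\<And>i j. 0 \<le> c2 i j"
  shows "opt_cost c1 c2 \<theta> (\<alpha> *\<^sub>R lam) \<le> \<alpha> * opt_cost c1 c2 \<theta> lam"
proof -
  \<comment> \<open>Dividing by \<alpha> turns the claim into a lower bound for the objective at
    each feasible point of the unscaled program, so no minimizer has to be exhibited. Boundedness
    below lets the scaled point bound the infimum at \<open>\<alpha> *\<^sub>R lam\<close>;
    nonemptiness then allows passing to the infimum at \<open>lam\<close>.\<close>
  have "opt_cost c1 c2 \<theta> (\<alpha> *\<^sub>R lam) / \<alpha> \<le> lp_objective c1 c2 x y"
    if "(x, y) \<in> lp_feasible \<theta> lam" for x y
  proof -
    have "opt_cost c1 c2 \<theta> (\<alpha> *\<^sub>R lam) \<le> lp_objective c1 c2 (\<alpha> *\<^sub>R x) (\<alpha> *\<^sub>R y)"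
      unfolding opt_cost_def
      using cINF_lower[OF lp_objective_bdd_below[OF assms(3,4)]
          lp_feasible_scaleR[OF assms(1) lam that]] by simp
    then show ?thesis
      using assms(1) by (simp add: lp_objective_scaleR divide_le_eq mult.commute)
  qed
  then have "opt_cost c1 c2 \<theta> (\<alpha> *\<^sub>R lam) / \<alpha> \<le> opt_cost c1 c2 \<theta> lam"
    unfolding opt_cost_def[of c1 c2 \<theta> lam]
    by (intro cINF_greatest lp_feasible_nonempty lam) auto
  then show ?thesis
    using assms(1) by (simp add: divide_le_eq mult.commute)
qed

theorem proposition2:
  fixes c1 :: "'n::finite \<Rightarrow> real"
    and c2 :: "'n \<Rightarrow> 'n \<Rightarrow> real"
    and \<theta> :: "'n \<Rightarrow> real"
    and lo hi :: "real ^ 'n"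
  assumes c1_pos: "\<And>i. 0 < c1 i"
    and c2_pos: "\<And>i j. 0 < c2 i j"
    and c1_eq: "\<And>i. c1 i = c2 i i"
    and c2_diag_le: "\<And>i j. c2 i i \<le> c2 i j"
    and c2_sym: "\<And>i j. c2 i j = c2 j i"
    and theta_nonneg: "\<And>i. 0 \<le> \<theta> i"
    and lo_pos: "\<And>i. 0 < lo $ i"
  shows "\<forall>\<alpha>>1. \<forall>lam\<in>cbox lo hi. \<alpha> *\<^sub>R lam \<in> cbox lo hi \<longrightarrow>
    opt_cost c1 c2 \<theta> (\<alpha> *\<^sub>R lam) / norm (\<alpha> *\<^sub>R lam) \<le> opt_cost c1 c2 \<theta> lam / norm lam"
proof (intro allI impI ballI)
  fix \<alpha> :: real and lam :: "real ^ 'n"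
  assume \<alpha>: "1 < \<alpha>" and lam: "lam \<in> cbox lo hi"
  have "0 \<le> lam $ i" for i
    using lam lo_pos[of i] by (auto simp: mem_box_cart intro: order_trans[OF less_imp_le])
  then have "opt_cost c1 c2 \<theta> (\<alpha> *\<^sub>R lam) \<le> \<alpha> * opt_cost c1 c2 \<theta> lam"
    using \<alpha> c1_pos c2_pos by (intro opt_cost_scaleR_le) (auto intro: less_imp_le)
  then have "opt_cost c1 c2 \<theta> (\<alpha> *\<^sub>R lam) / norm (\<alpha> *\<^sub>R lam)
      \<le> \<alpha> * opt_cost c1 c2 \<theta> lam / norm (\<alpha> *\<^sub>R lam)"
    by (intro divide_right_mono) auto
  \<comment> \<open>The norm is absolutely homogeneous and \<alpha> is positive, so \<alpha>
    cancels.\<close>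
  also have "\<dots> = opt_cost c1 c2 \<theta> lam / norm lam"
    using \<alpha> by simp
  finally show "opt_cost c1 c2 \<theta> (\<alpha> *\<^sub>R lam) / norm (\<alpha> *\<^sub>R lam) \<le> opt_cost c1 c2 \<theta> lam / norm lam" .
qed

end
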